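(* $C_3^{*}$ is the only nontrivial uniquely $C_4^{+}$-saturated graph with exactly one triangle (up to isomorphism).
   Context: All graphs are finite, simple and undirected. $C_4^{+}$ (the diamond) is the graph obtained from a $4$-cycle by adding one chord, i.e. $K_4$ minus an edge. $C_3^{*}$ is the graph consisting of a triangle with one pendant edge attached. For a graph $H$, a graph $G$ is uniquely $H$-saturated if $G$ contains no subgraph isomorphic to $H$, but for every pair of non-adjacent vertices $u,v$ of $G$, the graph $G+uv$ contains exactly one subgraph isomorphic to $H$. A uniquely $H$-saturated graph is nontrivial if it has at least $|V(H)|$ vertices. A triangle is a subgraph isomorphic to $K_3$. *)

theory Defs
  imports Main
begin

datatype 'a ugraph = UGraph (verts: "'a set") (edges: "'a set set")

definition simple_graph :: "'a ugraph \<Rightarrow> bool" where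
  "simple_graph G \<longleftrightarrow> finite (verts G) \<and>
     edges G \<subseteq> {{u, v} | u v. u \<in> verts G \<and> v \<in> verts G \<and> u \<noteq> v}"

definition subgraph :: "'a ugraph \<Rightarrow> 'a ugraph \<Rightarrow> bool" where
  "subgraph S G \<longleftrightarrow> simple_graph S \<and> verts S \<subseteq> verts G \<and> edges S \<subseteq> edges G"

definition isomorphic :: "'a ugraph \<Rightarrow> 'b ugraph \<Rightarrow> bool" where
  "isomorphic G H \<longleftrightarrow> (\<exists>f. bij_betw f (verts G) (verts H) \<and>
     (\<forall>u \<in> verts G. \<forall>v \<in> verts G. {u, v} \<in> edges G \<longleftrightarrow> {f u, f v} \<in> edges H))"

text \<open>Subgraphs are counted as subgraphs (vertex set together with edge set, not necessarily
  induced), not as embeddings, so automorphisms of \<^term>\<open>H\<close> do not matter.\<close>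

definition copies :: "'b ugraph \<Rightarrow> 'a ugraph \<Rightarrow> 'a ugraph set" where
  "copies H G = {S. subgraph S G \<and> isomorphic S H}"

definition add_edge :: "'a ugraph \<Rightarrow> 'a \<Rightarrow> 'a \<Rightarrow> 'a ugraph" where
  "add_edge G u v = UGraph (verts G) (insert {u, v} (edges G))"

definition uniquely_saturated :: "'b ugraph \<Rightarrow> 'a ugraph \<Rightarrow> bool" where
  "uniquely_saturated H G \<longleftrightarrow> simple_graph G \<and> copies H G = {} \<and>
     (\<forall>u \<in> verts G. \<forall>v \<in> verts G. u \<noteq> v \<longrightarrow> {u, v} \<notin> edges G \<longrightarrow>
        (\<exists>!S. S \<in> copies H (add_edge G u v)))"

definition nontrivial_uniquely_saturated :: "'b ugraph \<Rightarrow> 'a ugraph \<Rightarrow> bool" where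
  "nontrivial_uniquely_saturated H G \<longleftrightarrow>
     uniquely_saturated H G \<and> card (verts H) \<le> card (verts G)"

definition K3 :: "nat ugraph" where
  "K3 = UGraph {0, 1, 2} {{0, 1}, {1, 2}, {2, 0}}"

definition C4 :: "nat ugraph" where
  "C4 = UGraph {0, 1, 2, 3} {{0, 1}, {1, 2}, {2, 3}, {3, 0}}"

definition C4_plus :: "nat ugraph" where
  "C4_plus = add_edge C4 0 2"

definition C3_star :: "nat ugraph" where
  "C3_star = UGraph {0, 1, 2, 3} {{0, 1}, {1, 2}, {2, 0}, {0, 3}}"

definition exactly_one_triangle :: "'a ugraph \<Rightarrow> bool" where
  "exactly_one_triangle G \<longleftrightarrow> (\<exists>!T. T \<in> copies K3 G)"

end

theory Submission
  imports Defs
begin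

text \<open>
  A diamond consists of two triangles sharing an edge. So in a uniquely saturated graph with a
  single triangle \<open>T\<close>, two non-adjacent vertices have either exactly two common neighbours and
  no triangle edge on the connecting paths, or exactly one common neighbour, reached through one
  edge of \<open>T\<close>. Consequently a vertex outside \<open>T\<close> has at most one neighbour in \<open>T\<close>, and the
  vertices outside \<open>T\<close> that have one form an independent set. Let \<open>D\<close> be the set of vertices
  with no neighbour in \<open>T\<close>, and \<open>A\<close>, \<open>B\<close> the outer neighbourhoods of two vertices of \<open>T\<close>.

  If \<open>D\<close> is nonempty, each of its vertices has exactly two neighbours in \<open>A\<close> and two in \<open>B\<close>.
  Fix \<open>u \<in> A\<close> and let \<open>R = N(u) \<inter> D\<close>. Each other vertex of \<open>A\<close> has exactly one neighbour in \<open>R\<close>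
  and each vertex of \<open>B\<close> exactly two, so counting edges gives \<open>|A| - 1 = |R| = |B|\<close>. By symmetry
  \<open>|B| - 1 = |A|\<close>, a contradiction. If \<open>D\<close> is empty, two vertices outside \<open>T\<close> would have at most
  one common neighbour, so there is only one such vertex, and it is a pendant vertex.
\<close>

section \<open>Copies as images\<close>

definition image_graph :: "('b \<Rightarrow> 'a) \<Rightarrow> 'b ugraph \<Rightarrow> 'a ugraph" where
  "image_graph g H = UGraph (g ` verts H) ((`) g ` edges H)"

lemma simple_graph_edgeD:
  assumes "simple_graph G" "{x, y} \<in> edges G"
  shows "x \<in> verts G" "y \<in> verts G" "x \<noteq> y"
  using assms unfolding simple_graph_def by (auto simp: doubleton_eq_iff dest!: subsetD)

lemma simple_graph_edgeE:
  assumes "simple_graph G" "e \<in> edges G"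
  obtains x y where "e = {x, y}" "x \<in> verts G" "y \<in> verts G" "x \<noteq> y"
  using assms unfolding simple_graph_def by blast

lemma simple_graph_image_graph:
  assumes "simple_graph H" "inj_on g (verts H)"
  shows "simple_graph (image_graph g H)"
proof -
  have "\<exists>u v. g ` e = {u, v} \<and> u \<in> g ` verts H \<and> v \<in> g ` verts H \<and> u \<noteq> v"
    if e: "e \<in> edges H" for e
  proof -
    obtain x y where "e = {x, y}" "x \<in> verts H" "y \<in> verts H" "x \<noteq> y"
      using simple_graph_edgeE[OF assms(1) e] .
    then have "g ` e = {g x, g y}" "g x \<in> g ` verts H" "g y \<in> g ` verts H" "g x \<noteq> g y"
      using assms(2) by (auto dest: inj_onD)
    then show ?thesis by blast
  qed
  then show ?thesis
    using assms(1) unfolding simple_graph_def image_graph_def by auto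
qed

lemma isomorphic_image_graph:
  assumes "simple_graph H" "inj_on g (verts H)"
  shows "isomorphic (image_graph g H) H"
proof -
  let ?f = "the_inv_into (verts H) g"
  have f: "?f (g x) = x" if "x \<in> verts H" for x
    using assms(2) that by (rule the_inv_into_f_f)
  have "bij_betw ?f (g ` verts H) (verts H)"
    using assms(2) by (simp add: bij_betw_the_inv_into inj_on_imp_bij_betw)
  moreover have "({g x, g y} \<in> (`) g ` edges H) = ({x, y} \<in> edges H)"
    if "x \<in> verts H" "y \<in> verts H" for x y
  proof
    assume "{g x, g y} \<in> (`) g ` edges H"
    then obtain e where e: "e \<in> edges H" "g ` e = g ` {x, y}" by auto
    \<comment> \<open>Since \<open>g\<close> is injective only on \<open>verts H\<close>, an
      equality of images can be pulled back only between subsets of \<open>verts H\<close>.\<close>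
    have "e \<subseteq> verts H" using simple_graph_edgeE[OF assms(1) e(1)] by blast
    then have "e = {x, y}"
      using e(2) that inj_on_image_eq_iff[OF assms(2), of e "{x, y}"] by simp
    then show "{x, y} \<in> edges H" using e(1) by simp
  next
    assume "{x, y} \<in> edges H"
    then have "g ` {x, y} \<in> (`) g ` edges H" by (rule imageI)
    then show "{g x, g y} \<in> (`) g ` edges H" by simp
  qed
  ultimately show ?thesis
    unfolding isomorphic_def image_graph_def by (intro exI[of _ ?f]) (auto simp: f)
qed

text \<open>The embedding is the inverse of the isomorphism. Simplicity of both graphs matters
  because \<open>isomorphic\<close> speaks only about edges written as pairs of vertices.\<close>

lemma isomorphic_imp_image_graph:
  assumes "simple_graph S" "simple_graph H" "isomorphic S H"
  obtains g where "inj_on g (verts H)" "S = image_graph g H"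
proof -
  obtain f where f: "bij_betw f (verts S) (verts H)"
    and fe: "\<And>u v. u \<in> verts S \<Longrightarrow> v \<in> verts S \<Longrightarrow> {u, v} \<in> edges S \<longleftrightarrow> {f u, f v} \<in> edges H"
    using assms(3) unfolding isomorphic_def by blast
  let ?g = "the_inv_into (verts S) f"
  have g: "bij_betw ?g (verts H) (verts S)" using f by (rule bij_betw_the_inv_into)
  have fg: "f (?g x) = x" if "x \<in> verts H" for x
    using f that by (simp add: bij_betw_def f_the_inv_into_f)
  have gf: "?g (f x) = x" if "x \<in> verts S" for x
    using f that by (simp add: bij_betw_def the_inv_into_f_f)
  have "edges S = (`) ?g ` edges H"
  proof (intro set_eqI iffI)
    fix e assume e: "e \<in> edges S"
    obtain x y where xy: "e = {x, y}" "x \<in> verts S" "y \<in> verts S"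
      using simple_graph_edgeE[OF assms(1) e] .
    have "{f x, f y} \<in> edges H" using fe xy e by simp
    moreover have "e = ?g ` {f x, f y}" using gf xy by simp
    ultimately show "e \<in> (`) ?g ` edges H" by blast
  next
    fix e assume "e \<in> (`) ?g ` edges H"
    then obtain e' where e': "e' \<in> edges H" "e = ?g ` e'" by blast
    obtain x y where xy: "e' = {x, y}" "x \<in> verts H" "y \<in> verts H"
      using simple_graph_edgeE[OF assms(2) e'(1)] .
    have "?g x \<in> verts S" "?g y \<in> verts S" using g xy by (auto simp: bij_betw_def)
    then have "{?g x, ?g y} \<in> edges S" using fe[of "?g x" "?g y"] fg xy e' by simp
    then show "e \<in> edges S" using e' xy by simp
  qed
  then have "S = image_graph ?g H"
    using g by (cases S) (simp add: image_graph_def bij_betw_def)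
  then show thesis using that g by (auto simp: bij_betw_def)
qed

text \<open>Trades the isomorphism for an injection defined on the fixed graph \<open>H\<close>, so
  that for a concrete \<open>H\<close> a copy is described by the images of its few
  vertices.\<close>

lemma mem_copies_iff:
  assumes "simple_graph H"
  shows "S \<in> copies H G \<longleftrightarrow> (\<exists>g. inj_on g (verts H) \<and> g ` verts H \<subseteq> verts G \<and>
    (`) g ` edges H \<subseteq> edges G \<and> S = image_graph g H)"
proof
  assume "S \<in> copies H G"
  then have S: "simple_graph S" "isomorphic S H" "verts S \<subseteq> verts G" "edges S \<subseteq> edges G"
    unfolding copies_def subgraph_def by auto
  obtain g where "inj_on g (verts H)" "S = image_graph g H"
    using isomorphic_imp_image_graph[OF S(1) assms S(2)] .
  then show "\<exists>g. inj_on g (verts H) \<and> g ` verts H \<subseteq> verts G \<and>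
    (`) g ` edges H \<subseteq> edges G \<and> S = image_graph g H"
    using S by (auto simp: image_graph_def)
next
  assume "\<exists>g. inj_on g (verts H) \<and> g ` verts H \<subseteq> verts G \<and>
    (`) g ` edges H \<subseteq> edges G \<and> S = image_graph g H"
  then show "S \<in> copies H G"
    using isomorphic_image_graph[OF assms] simple_graph_image_graph[OF assms]
    by (auto simp: copies_def subgraph_def) (auto simp: image_graph_def)
qed

section \<open>Triangles and diamonds described by their vertices\<close>

lemma simple_graph_add_edge:
  "simple_graph G \<Longrightarrow> u \<in> verts G \<Longrightarrow> v \<in> verts G \<Longrightarrow> u \<noteq> v \<Longrightarrow> simple_graph (add_edge G u v)"
  unfolding simple_graph_def add_edge_def by auto

lemma simple_graph_iff:
  "simple_graph G \<longleftrightarrow> finite (verts G) \<and>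
    (\<forall>e\<in>edges G. \<exists>u\<in>verts G. \<exists>v\<in>verts G. u \<noteq> v \<and> e = {u, v})"
  unfolding simple_graph_def by blast

lemma simple_graph_K3: "simple_graph K3"
  unfolding simple_graph_iff K3_def by (auto simp: doubleton_eq_iff)

lemma simple_graph_C4_plus: "simple_graph C4_plus"
  unfolding simple_graph_iff C4_plus_def C4_def add_edge_def by (auto simp: doubleton_eq_iff)

lemma simple_graph_C3_star: "simple_graph C3_star"
  unfolding simple_graph_iff C3_star_def by (auto simp: doubleton_eq_iff)

definition triangle :: "'a \<Rightarrow> 'a \<Rightarrow> 'a \<Rightarrow> 'a ugraph" where
  "triangle x y z = UGraph {x, y, z} {{x, y}, {y, z}, {z, x}}"

text \<open>Shows that a triangle depends only on its vertex set, which settles all reorderings of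
  the three vertices at once.\<close>

lemma triangle_conv_complete:
  assumes "x \<noteq> y" "y \<noteq> z" "z \<noteq> x"
  shows "triangle x y z =
    (let X = {x, y, z} in UGraph X {{p, q} | p q. p \<in> X \<and> q \<in> X \<and> p \<noteq> q})"
proof -
  have "{{x, y}, {y, z}, {z, x}} =
    {{p, q} | p q. p \<in> {x, y, z} \<and> q \<in> {x, y, z} \<and> p \<noteq> q}"
    using assms by blast
  then show ?thesis by (simp only: triangle_def Let_def)
qed

text \<open>The chord of the 4-cycle joins the first two arguments.\<close>

definition diamond :: "'a \<Rightarrow> 'a \<Rightarrow> 'a \<Rightarrow> 'a \<Rightarrow> 'a ugraph" where
  "diamond x y p q = UGraph {x, p, y, q} {{x, y}, {x, p}, {p, y}, {y, q}, {q, x}}"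

lemma copies_K3_iff:
  assumes "simple_graph G"
  shows "S \<in> copies K3 G \<longleftrightarrow> (\<exists>x y z. S = triangle x y z \<and>
    {x, y} \<in> edges G \<and> {y, z} \<in> edges G \<and> {z, x} \<in> edges G)" (is "_ \<longleftrightarrow> ?R")
proof
  assume "S \<in> copies K3 G"
  then obtain g where "(`) g ` edges K3 \<subseteq> edges G" "S = image_graph g K3"
    unfolding mem_copies_iff[OF simple_graph_K3] by blast
  then show ?R
    by (intro exI[of _ "g 0"] exI[of _ "g 1"] exI[of _ "g 2"])
      (auto simp: K3_def image_graph_def triangle_def)
next
  assume ?R
  then obtain x y z where S: "S = triangle x y z"
    and e: "{x, y} \<in> edges G" "{y, z} \<in> edges G" "{z, x} \<in> edges G" by blast
  let ?g = "\<lambda>i::nat. if i = 0 then x else if i = 1 then y else z"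
  have "inj_on ?g (verts K3)" "?g ` verts K3 \<subseteq> verts G"
    using e[THEN simple_graph_edgeD(3)[OF assms]] e[THEN simple_graph_edgeD(1)[OF assms]]
    by (auto simp: K3_def)
  moreover have "(`) ?g ` edges K3 \<subseteq> edges G" "S = image_graph ?g K3"
    using S e by (auto simp: K3_def image_graph_def triangle_def insert_commute[of _ _ "{}"])
  ultimately show "S \<in> copies K3 G" unfolding mem_copies_iff[OF simple_graph_K3] by blast
qed

text \<open>Only the tips \<open>p\<close> and \<open>q\<close> of the diamond need to be declared
  distinct: any other two of its vertices are joined by an edge of a simple graph.\<close>

lemma copies_C4_plus_iff:
  assumes "simple_graph G"
  shows "S \<in> copies C4_plus G \<longleftrightarrow> (\<exists>x y p q. p \<noteq> q \<and> S = diamond x y p q \<and>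
    {x, y} \<in> edges G \<and> {x, p} \<in> edges G \<and> {y, p} \<in> edges G \<and> {x, q} \<in> edges G \<and>
    {y, q} \<in> edges G)" (is "_ \<longleftrightarrow> ?R")
proof
  assume "S \<in> copies C4_plus G"
  then obtain g where "inj_on g (verts C4_plus)" "(`) g ` edges C4_plus \<subseteq> edges G"
      "S = image_graph g C4_plus"
    unfolding mem_copies_iff[OF simple_graph_C4_plus] by blast
  then show ?R
    \<comment> \<open>The chord of \<open>C4_plus\<close> is \<open>{0, 2}\<close>, so 0 and 2 give
      the chord and 1 and 3 the tips.\<close>
    by (intro exI[of _ "g 0"] exI[of _ "g 2"] exI[of _ "g 1"] exI[of _ "g 3"])
      (simp add: C4_plus_def C4_def add_edge_def image_graph_def diamond_def insert_commute[of _ _ "{}"])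
next
  assume ?R
  then obtain x y p q where S: "p \<noteq> q" "S = diamond x y p q"
    and e: "{x, y} \<in> edges G" "{x, p} \<in> edges G" "{y, p} \<in> edges G" "{x, q} \<in> edges G"
      "{y, q} \<in> edges G" by blast
  let ?g = "\<lambda>i::nat. if i = 0 then x else if i = 2 then y else if i = 1 then p else q"
  have "inj_on ?g (verts C4_plus)" "?g ` verts C4_plus \<subseteq> verts G"
    using S(1) e[THEN simple_graph_edgeD(3)[OF assms]] e[THEN simple_graph_edgeD(1)[OF assms]]
      e[THEN simple_graph_edgeD(2)[OF assms]]
    by (auto simp: C4_plus_def C4_def add_edge_def)
  moreover have "(`) ?g ` edges C4_plus \<subseteq> edges G" "S = image_graph ?g C4_plus"
    using S e by (simp_all add: C4_plus_def C4_def add_edge_def image_graph_def diamond_def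
      insert_commute)
  ultimately show "S \<in> copies C4_plus G"
    unfolding mem_copies_iff[OF simple_graph_C4_plus] by blast
qed

section \<open>The triangle with a pendant edge\<close>

lemma card_copies_C4_plus:
  assumes "S \<in> copies C4_plus G"
  shows "card (verts S) = 4" "card (edges S) = 5"
proof -
  obtain g where g: "inj_on g (verts C4_plus)" "S = image_graph g C4_plus"
    using assms unfolding mem_copies_iff[OF simple_graph_C4_plus] by blast
  have "card (verts C4_plus) = 4" "card (edges C4_plus) = 5"
    by (simp_all add: C4_plus_def C4_def add_edge_def doubleton_eq_iff)
  \<comment> \<open>Edges are subsets of \<open>verts C4_plus\<close>, and taking images under an
    injection is injective on the powerset.\<close>
  moreover have "inj_on ((`) g) (edges C4_plus)"
    using g(1) by (rule inj_on_subset[OF inj_on_image_Pow])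
      (auto simp: C4_plus_def C4_def add_edge_def)
  ultimately show "card (verts S) = 4" "card (edges S) = 5"
    using g by (simp_all add: image_graph_def card_image)
qed

text \<open>A diamond has 4 vertices and 5 edges, so it exhausts any graph with no more than that.
  This gives uniqueness of the copy in \<open>C3_star\<close> plus an edge without inspecting
  embeddings.\<close>

lemma copies_C4_plus_eq_self:
  assumes "S \<in> copies C4_plus G" "finite (verts G)" "finite (edges G)"
    "card (verts G) \<le> 4" "card (edges G) \<le> 5"
  shows "S = G"
proof -
  have "verts S \<subseteq> verts G" "edges S \<subseteq> edges G"
    using assms(1) by (auto simp: copies_def subgraph_def)
  then have "verts S = verts G" "edges S = edges G"
    using card_copies_C4_plus[OF assms(1)] assms(2-5) by (simp_all add: card_seteq)
  then show ?thesis by (rule ugraph.expand[OF conjI])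
qed

text \<open>The pairs \<open>{1, 3}\<close> and \<open>{2, 3}\<close> are the only non-edges of
  \<open>C3_star\<close>.\<close>

lemma C3_star_add_edge_unique_copy:
  assumes "u \<in> {1, 2}"
  shows "\<exists>!S. S \<in> copies C4_plus (add_edge C3_star u 3)"
proof (rule ex_ex1I)
  have s: "simple_graph (add_edge C3_star u 3)"
    using simple_graph_C3_star assms
    by (intro simple_graph_add_edge) (auto simp: C3_star_def)
  \<comment> \<open>Here \<open>3 - u\<close> is the other element of \<open>{1, 2}\<close>. The old
    triangle and the new triangle on 0, \<open>u\<close>, 3 share the chord
    \<open>{0, u}\<close>.\<close>
  have "diamond 0 u (3 - u) 3 \<in> copies C4_plus (add_edge C3_star u 3)"
    unfolding copies_C4_plus_iff[OF s]
    by (rule exI[of _ 0], rule exI[of _ u], rule exI[of _ "3 - u"], rule exI[of _ 3])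
      (use assms in \<open>auto simp: C3_star_def add_edge_def doubleton_eq_iff\<close>)
  then show "\<exists>S. S \<in> copies C4_plus (add_edge C3_star u 3)" ..
  have "S = add_edge C3_star u 3" if "S \<in> copies C4_plus (add_edge C3_star u 3)" for S
    using that
    by (rule copies_C4_plus_eq_self)
      (use assms in \<open>auto simp: C3_star_def add_edge_def doubleton_eq_iff\<close>)
  then show "S = S'" if "S \<in> copies C4_plus (add_edge C3_star u 3)"
    "S' \<in> copies C4_plus (add_edge C3_star u 3)" for S S'
    using that by metis
qed

lemma nontrivial_uniquely_saturated_C3_star:
  "nontrivial_uniquely_saturated C4_plus C3_star"
proof -
  have "copies C4_plus C3_star = {}"
  proof (rule ccontr)
    assume "copies C4_plus C3_star \<noteq> {}"
    then obtain S where S: "S \<in> copies C4_plus C3_star" by blast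
    then have "S = C3_star"
      by (rule copies_C4_plus_eq_self) (auto simp: C3_star_def doubleton_eq_iff)
    \<comment> \<open>\<open>C3_star\<close> has four edges, a diamond five.\<close>
    then show False using card_copies_C4_plus(2)[OF S]
      by (simp add: C3_star_def doubleton_eq_iff)
  qed
  moreover have "\<exists>!S. S \<in> copies C4_plus (add_edge C3_star u v)"
    if "u \<in> verts C3_star" "v \<in> verts C3_star" "u \<noteq> v" "{u, v} \<notin> edges C3_star" for u v
  proof -
    have "(u \<in> {1, 2} \<and> v = 3) \<or> (v \<in> {1, 2} \<and> u = 3)"
      using that by (auto simp: C3_star_def)
    moreover have "add_edge C3_star u v = add_edge C3_star v u"
      by (simp add: add_edge_def insert_commute)
    ultimately show ?thesis using C3_star_add_edge_unique_copy by metis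
  qed
  moreover have "card (verts C4_plus) \<le> card (verts C3_star)"
    by (simp add: C4_plus_def C4_def add_edge_def C3_star_def)
  ultimately show ?thesis
    using simple_graph_C3_star
    by (auto simp: nontrivial_uniquely_saturated_def uniquely_saturated_def)
qed

lemma exactly_one_triangle_C3_star: "exactly_one_triangle C3_star"
  unfolding exactly_one_triangle_def
proof
  show "triangle 0 1 2 \<in> copies K3 C3_star"
    unfolding copies_K3_iff[OF simple_graph_C3_star]
    by (rule exI[of _ 0], rule exI[of _ 1], rule exI[of _ 2]) (simp add: C3_star_def)
  show "S = triangle 0 1 2" if S: "S \<in> copies K3 C3_star" for S
  proof -
    obtain x y z where xyz: "S = triangle x y z" "{x, y} \<in> edges C3_star"
      "{y, z} \<in> edges C3_star" "{z, x} \<in> edges C3_star"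
      using S unfolding copies_K3_iff[OF simple_graph_C3_star] by blast
    have ne: "x \<noteq> y" "y \<noteq> z" "z \<noteq> x"
      using xyz simple_graph_edgeD(3)[OF simple_graph_C3_star] by blast+
    have "{x, y, z} \<subseteq> {0, 1, 2}"
      using xyz(2-4) ne by (auto simp: C3_star_def doubleton_eq_iff)
    then have "{x, y, z} = {0, 1, 2}"
      using ne by (intro card_subset_eq) auto
    then show ?thesis using xyz(1) ne by (simp add: triangle_conv_complete del: insert_iff)
  qed
qed

section \<open>Uniqueness\<close>

text \<open>Saturation restated for neighbourhoods. In \<open>nonadj_cases\<close> the new edge
  \<open>uv\<close> is either the chord of the new diamond or one of its four rim edges. The last
  two assumptions say that the diamond is unique: two with chord \<open>uv\<close> cannot coexist,
  nor can one with chord \<open>uv\<close> and one with \<open>uv\<close> on the rim.\<close>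

locale one_triangle_saturated =
  fixes V :: "'a set" and adj :: "'a \<Rightarrow> 'a \<Rightarrow> bool" and T :: "'a set"
  assumes finite_V: "finite V"
    and adj_sym: "adj x y \<Longrightarrow> adj y x"
    and adj_V: "adj x y \<Longrightarrow> x \<in> V"
    and T_V: "T \<subseteq> V"
    and card_T: "card T = 3"
    and T_adj: "x \<in> T \<Longrightarrow> y \<in> T \<Longrightarrow> x \<noteq> y \<Longrightarrow> adj x y"
    and triangle_T: "adj x y \<Longrightarrow> adj y z \<Longrightarrow> adj x z \<Longrightarrow> x \<in> T"
    and nonadj_cases: "u \<in> V \<Longrightarrow> v \<in> V \<Longrightarrow> u \<noteq> v \<Longrightarrow> \<not> adj u v \<Longrightarrow>
      (\<exists>p q. p \<noteq> q \<and> adj u p \<and> adj v p \<and> adj u q \<and> adj v q) \<or>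
      (\<exists>w z. adj u w \<and> adj v w \<and> adj w z \<and> (adj u z \<or> adj v z))"
    and no_three_common: "u \<noteq> v \<Longrightarrow> \<not> adj u v \<Longrightarrow> adj u p \<Longrightarrow> adj v p \<Longrightarrow> adj u q \<Longrightarrow> adj v q \<Longrightarrow>
      adj u r \<Longrightarrow> adj v r \<Longrightarrow> r = p \<or> r = q \<or> p = q"
    and common_on_triangle_unique: "u \<noteq> v \<Longrightarrow> \<not> adj u v \<Longrightarrow> adj u p \<Longrightarrow> adj v p \<Longrightarrow>
      adj u q \<Longrightarrow> adj v q \<Longrightarrow> adj u z \<Longrightarrow> adj p z \<Longrightarrow> q = p"
begin

section \<open>Common neighbours around the triangle\<close>

definition common :: "'a \<Rightarrow> 'a \<Rightarrow> 'a set" where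
  "common u v = {w. adj u w \<and> adj v w}"

definition outer :: "'a \<Rightarrow> 'a set" where
  "outer t = {v. v \<notin> T \<and> adj t v}"

definition far :: "'a set" where
  "far = {v \<in> V. v \<notin> T \<and> (\<forall>t\<in>T. \<not> adj t v)}"

lemma finite_outer: "finite (outer t)"
  using adj_V adj_sym by (intro finite_subset[OF _ finite_V]) (auto simp: outer_def)

lemma finite_far: "finite far"
  using finite_V by (simp add: far_def)

lemma outside_T_cases: "v \<in> V \<Longrightarrow> v \<notin> T \<Longrightarrow> v \<in> far \<or> (\<exists>t\<in>T. v \<in> outer t)"
  by (auto simp: far_def outer_def)

text \<open>The hypothesis \<open>no\<close> rules out the rim case of \<open>nonadj_cases\<close>,
  so there are two common neighbours, and \<open>no_three_common\<close> forbids a third.\<close>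

lemma card_common:
  assumes "u \<in> V" "v \<in> V" "u \<noteq> v" "\<not> adj u v"
    and no: "\<And>w z. adj u w \<Longrightarrow> adj v w \<Longrightarrow> adj w z \<Longrightarrow> adj u z \<or> adj v z \<Longrightarrow> False"
  shows "card (common u v) = 2"
proof -
  obtain p q where pq: "p \<noteq> q" "adj u p" "adj v p" "adj u q" "adj v q"
    using nonadj_cases[OF assms(1-4)] no by blast
  then have "common u v = {p, q}"
    using no_three_common[OF assms(3,4)] by (auto simp: common_def)
  then show ?thesis using pq by simp
qed

text \<open>In the rim case \<open>u\<close> or \<open>v\<close> would lie on a triangle, hence in
  \<open>T\<close>.\<close>

lemma card_common_outside:
  assumes "u \<in> V" "v \<in> V" "u \<noteq> v" "\<not> adj u v" "u \<notin> T" "v \<notin> T"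
  shows "card (common u v) = 2"
  using assms(1-4)
proof (rule card_common)
  fix w z assume "adj u w" "adj v w" "adj w z" "adj u z \<or> adj v z"
  then show False using triangle_T assms(5,6) by blast
qed

text \<open>Two neighbours \<open>t\<close> and \<open>s\<close> of \<open>v\<close> in
  \<open>T\<close> would make \<open>v\<close> a vertex of a second triangle.\<close>

lemma outer_adj_T:
  assumes "t \<in> T" "v \<in> outer t" "s \<in> T" "adj s v"
  shows "s = t"
  using assms T_adj[of t s] triangle_T[of v t s] adj_sym by (auto simp: outer_def)

lemma third_T:
  assumes "t \<in> T" "s \<in> T"
  obtains r where "r \<in> T" "r \<noteq> t" "r \<noteq> s"
proof -
  have "\<not> T \<subseteq> {t, s}"
    using card_T card_mono[of "{t, s}" T] card_insert_le_m1[of 2 "{s}" t] by auto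
  then show thesis using that by blast
qed

text \<open>For \<open>t = s\<close> an edge \<open>uv\<close> would close a triangle with
  \<open>t\<close>. Otherwise the non-adjacent \<open>s\<close> and \<open>u\<close> have the common
  neighbours \<open>t\<close> and \<open>v\<close>, although \<open>st\<close> is an edge of the
  triangle \<open>T\<close>, which allows only one.\<close>

lemma outer_not_adj:
  assumes "t \<in> T" "u \<in> outer t" "s \<in> T" "v \<in> outer s"
  shows "\<not> adj u v"
proof
  assume uv: "adj u v"
  show False
  proof (cases "t = s")
    case True
    then show False
      using assms uv triangle_T[of u v t] adj_sym by (auto simp: outer_def)
  next
    case False
    obtain r where r: "r \<in> T" "r \<noteq> t" "r \<noteq> s" using third_T assms(1,3) .
    have "v = t"
    proof (rule common_on_triangle_unique)
      show "s \<noteq> u" using assms by (auto simp: outer_def)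
      show "\<not> adj s u" using outer_adj_T assms False by blast
      show "adj s t" "adj s r" "adj t r" using T_adj assms r False by auto
      show "adj u t" "adj s v" "adj u v" using assms uv adj_sym by (auto simp: outer_def)
    qed
    then show False using assms by (auto simp: outer_def)
  qed
qed

lemma common_outer_far:
  assumes "t \<in> T" "s \<in> T" "u \<in> outer t" "v \<in> outer s" "w \<in> common u v" "w \<notin> far"
  shows "w = t \<and> w = s"
proof -
  have w: "adj u w" "adj v w" using assms by (auto simp: common_def)
  show ?thesis
  proof (cases "w \<in> T")
    case True
    then show ?thesis using outer_adj_T assms w adj_sym by blast
  next
    case False
    then show ?thesis using w outside_T_cases[of w] outer_not_adj assms adj_V adj_sym by blast
  qed
qed

lemma outerD: "v \<in> outer t \<Longrightarrow> v \<in> V \<and> v \<notin> T \<and> adj t v \<and> adj v t"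
  using adj_sym adj_V by (auto simp: outer_def)

lemma card_far_common_distinct:
  assumes "t \<in> T" "s \<in> T" "t \<noteq> s" "u \<in> outer t" "v \<in> outer s"
  shows "card {d \<in> far. adj u d \<and> adj v d} = 2"
proof -
  have "u \<noteq> v" using outer_adj_T assms outerD by blast
  then have "card (common u v) = 2"
    using assms outerD outer_not_adj by (intro card_common_outside) blast+
  moreover have "common u v = {d \<in> far. adj u d \<and> adj v d}"
    using common_outer_far[OF assms(1,2,4,5)] assms(3) by (auto simp: common_def)
  ultimately show ?thesis by simp
qed

text \<open>One of the two common neighbours is \<open>t\<close> itself, which leaves a single one
  in \<open>far\<close>.\<close>

lemma card_far_common_same:
  assumes "t \<in> T" "u \<in> outer t" "v \<in> outer t" "u \<noteq> v"
  shows "card {d \<in> far. adj u d \<and> adj v d} = 1"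
proof -
  have "card (common u v) = 2"
    using assms outerD outer_not_adj by (intro card_common_outside) blast+
  moreover have "common u v = insert t {d \<in> far. adj u d \<and> adj v d}"
    using common_outer_far[OF assms(1,1,2,3)] assms outerD by (auto simp: common_def)
  moreover have "t \<notin> far" using assms by (simp add: far_def)
  ultimately show ?thesis using finite_far by simp
qed

text \<open>In the rim case the common neighbour \<open>w\<close> of \<open>t\<close> and
  \<open>d\<close> lies on a triangle, hence in \<open>T\<close>, but \<open>d\<close> has no
  neighbour there. Both common neighbours lie outside \<open>T\<close> for the same reason.\<close>

lemma card_outer_far:
  assumes "t \<in> T" "d \<in> far"
  shows "card {u \<in> outer t. adj u d} = 2"
proof -
  have "card (common t d) = 2"
  proof (rule card_common)
    show "t \<in> V" "d \<in> V" "t \<noteq> d" "\<not> adj t d" using assms T_V by (auto simp: far_def)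
    fix w z assume w: "adj t w" "adj d w" "adj w z" "adj t z \<or> adj d z"
    then have "w \<in> T" using triangle_T adj_sym by blast
    then show False using w assms adj_sym by (auto simp: far_def)
  qed
  moreover have "common t d = {u \<in> outer t. adj u d}"
    using assms adj_sym by (auto simp: common_def outer_def far_def)
  ultimately show ?thesis by simp
qed

text \<open>Adjacent pairs are counted twice, between \<open>R\<close> and
  \<open>outer t - {u}\<close> (degrees 1 and 1) and between \<open>R\<close> and
  \<open>outer s\<close> (degrees 2 and 2). The choice of \<open>u\<close> in \<open>outer t\<close>
  causes the asymmetry that \<open>far_empty\<close> exploits by swapping \<open>t\<close> and
  \<open>s\<close>.\<close>

lemma card_outer_distinct:
  assumes "t \<in> T" "s \<in> T" "t \<noteq> s" "far \<noteq> {}"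
  shows "card (outer t) = Suc (card (outer s))"
proof -
  obtain d where "d \<in> far" using assms(4) by blast
  then have "card {u \<in> outer t. adj u d} = 2" by (rule card_outer_far[OF assms(1)])
  then obtain u where u: "u \<in> outer t" by (fastforce simp: card_2_iff)
  define R where "R = {d \<in> far. adj u d}"
  have fR: "finite R" using finite_far by (simp add: R_def)
  have "(\<Sum>d\<in>R. card {v \<in> outer t - {u}. adj v d}) = 1 * card (outer t - {u})"
  proof (rule sum_multicount)
    show "\<forall>v\<in>outer t - {u}. card {d \<in> R. adj v d} = 1"
    proof
      fix v assume "v \<in> outer t - {u}"
      then show "card {d \<in> R. adj v d} = 1"
        using card_far_common_same[OF assms(1) u, of v] by (auto simp: R_def conj_ac)
    qed
  qed (use fR finite_outer in auto)
  moreover have "card {v \<in> outer t - {u}. adj v d} = 1" if "d \<in> R" for d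
  proof -
    \<comment> \<open>Of the two neighbours of \<open>d\<close> in \<open>outer t\<close>, one is
      \<open>u\<close>, by the definition of \<open>R\<close>.\<close>
    have "{v \<in> outer t - {u}. adj v d} = {v \<in> outer t. adj v d} - {u}" by auto
    then show ?thesis
      using card_outer_far[OF assms(1), of d] that u by (simp add: R_def)
  qed
  ultimately have 1: "card R = card (outer t - {u})" by simp
  have "(\<Sum>d\<in>R. card {v \<in> outer s. adj v d}) = 2 * card (outer s)"
  proof (rule sum_multicount)
    show "\<forall>v\<in>outer s. card {d \<in> R. adj v d} = 2"
      using card_far_common_distinct[OF assms(1-3) u] by (auto simp: R_def conj_ac)
  qed (use fR finite_outer in auto)
  moreover have "(\<Sum>d\<in>R. card {v \<in> outer s. adj v d}) = (\<Sum>d\<in>R. 2)"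
    using card_outer_far[OF assms(2)] by (intro sum.cong) (auto simp: R_def)
  ultimately have "card R = card (outer s)" by simp
  then show ?thesis
    using 1 u finite_outer card_Suc_Diff1[of "outer t" u] by simp
qed

lemma far_empty: "far = {}"
proof (rule ccontr)
  assume far: "far \<noteq> {}"
  have "T \<noteq> {}" using card_T by auto
  then obtain t s where ts: "t \<in> T" "s \<in> T" "s \<noteq> t" using third_T by blast
  then show False
    using card_outer_distinct[of t s] card_outer_distinct[of s t] far by simp
qed

lemma outside_unique:
  assumes "u \<in> V - T" "v \<in> V - T"
  shows "u = v"
proof (rule ccontr)
  assume "u \<noteq> v"
  obtain t s where ts: "t \<in> T" "u \<in> outer t" "s \<in> T" "v \<in> outer s"
    using assms outside_T_cases far_empty by blast
  have "card (common u v) = 2"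
    using assms \<open>u \<noteq> v\<close> outer_not_adj[OF ts] by (intro card_common_outside) auto
  \<comment> \<open>This covers both cases: for distinct \<open>t\<close> and \<open>s\<close> there
    is no common neighbour at all.\<close>
  moreover have "common u v \<subseteq> {t}"
    using common_outer_far[OF ts(1,3,2,4)] far_empty by auto
  then have "card (common u v) \<le> 1" using card_mono[of "{t}"] by fastforce
  ultimately show False by simp
qed

end

section \<open>From copies of the diamond to conditions on neighbourhoods\<close>

lemma uniquely_saturated_imp_locale:
  fixes G :: "'a ugraph"
  assumes "uniquely_saturated C4_plus G" "exactly_one_triangle G"
  obtains T where "one_triangle_saturated (verts G) (\<lambda>x y. {x, y} \<in> edges G) T"
proof -
  let ?adj = "\<lambda>x y. {x, y} \<in> edges G"
  have G: "simple_graph G" using assms by (simp add: uniquely_saturated_def)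
  note edgeD = simple_graph_edgeD[OF G]
  obtain t where t: "t \<in> copies K3 G" "\<And>s. s \<in> copies K3 G \<Longrightarrow> s = t"
    using assms(2) unfolding exactly_one_triangle_def by blast
  then obtain a b c where abc: "t = triangle a b c" "?adj a b" "?adj b c" "?adj c a"
    unfolding copies_K3_iff[OF G] by blast
  have dist: "a \<noteq> b" "b \<noteq> c" "c \<noteq> a" using abc edgeD by auto
  have sym: "?adj x y \<longleftrightarrow> ?adj y x" for x y by (simp add: insert_commute)
  have no_diamond: False
    if "p \<noteq> q" "?adj x y" "?adj x p" "?adj y p" "?adj x q" "?adj y q" for x y p q
  proof -
    have "diamond x y p q \<in> copies C4_plus G"
      unfolding copies_C4_plus_iff[OF G] using that by blast
    then show False using assms(1) by (simp add: uniquely_saturated_def)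
  qed
  have unique: "diamond x y p q = diamond x' y' p' q'"
    if uv: "u \<in> verts G" "v \<in> verts G" "u \<noteq> v" "\<not> ?adj u v"
      and "p \<noteq> q" "{{x, y}, {x, p}, {y, p}, {x, q}, {y, q}} \<subseteq> insert {u, v} (edges G)"
      and "p' \<noteq> q'" "{{x', y'}, {x', p'}, {y', p'}, {x', q'}, {y', q'}} \<subseteq> insert {u, v} (edges G)"
    for u v x y p q x' y' p' q'
  proof -
    have s: "simple_graph (add_edge G u v)" using G uv(1-3) by (rule simple_graph_add_edge)
    have "diamond x y p q \<in> copies C4_plus (add_edge G u v)"
      unfolding copies_C4_plus_iff[OF s]
      by (rule exI[of _ x], rule exI[of _ y], rule exI[of _ p], rule exI[of _ q])
        (use that(5-8) in \<open>simp add: add_edge_def\<close>)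
    moreover have "diamond x' y' p' q' \<in> copies C4_plus (add_edge G u v)"
      unfolding copies_C4_plus_iff[OF s]
      by (rule exI[of _ x'], rule exI[of _ y'], rule exI[of _ p'], rule exI[of _ q'])
        (use that(5-8) in \<open>simp add: add_edge_def\<close>)
    ultimately show ?thesis using assms(1) uv unfolding uniquely_saturated_def by blast
  qed
  have "one_triangle_saturated (verts G) ?adj {a, b, c}"
  proof
    show "finite (verts G)" using G by (simp add: simple_graph_def)
    show "?adj y x" if "?adj x y" for x y using that sym by simp
    show "x \<in> verts G" if "?adj x y" for x y using that edgeD by blast
    show "{a, b, c} \<subseteq> verts G" using abc edgeD by blast
    show "card {a, b, c} = 3" using dist by auto
    show "?adj x y" if "x \<in> {a, b, c}" "y \<in> {a, b, c}" "x \<noteq> y" for x y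
      using that abc sym by blast
    show "x \<in> {a, b, c}" if "?adj x y" "?adj y z" "?adj x z" for x y z
    proof -
      have "triangle x y z \<in> copies K3 G"
        unfolding copies_K3_iff[OF G] using that sym by blast
      then have "triangle x y z = triangle a b c" using t abc by simp
      then show ?thesis by (auto simp: triangle_def)
    qed
    show "(\<exists>p q. p \<noteq> q \<and> ?adj u p \<and> ?adj v p \<and> ?adj u q \<and> ?adj v q) \<or>
      (\<exists>w z. ?adj u w \<and> ?adj v w \<and> ?adj w z \<and> (?adj u z \<or> ?adj v z))"
      if uv: "u \<in> verts G" "v \<in> verts G" "u \<noteq> v" "\<not> ?adj u v" for u v
    proof -
      have s: "simple_graph (add_edge G u v)" using G uv(1-3) by (rule simple_graph_add_edge)
      obtain S where "S \<in> copies C4_plus (add_edge G u v)"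
        using assms(1) uv unfolding uniquely_saturated_def by blast
      then obtain x y p q where xy: "p \<noteq> q" "{x, y} \<in> edges (add_edge G u v)"
        "{x, p} \<in> edges (add_edge G u v)" "{y, p} \<in> edges (add_edge G u v)"
        "{x, q} \<in> edges (add_edge G u v)" "{y, q} \<in> edges (add_edge G u v)"
        unfolding copies_C4_plus_iff[OF s] by blast
      have ne: "x \<noteq> y" "x \<noteq> p" "y \<noteq> p" "x \<noteq> q" "y \<noteq> q"
        using xy simple_graph_edgeD(3)[OF s] by auto
      have old: "e \<in> edges G" if "e \<in> edges (add_edge G u v)" "e \<noteq> {u, v}" for e
        using that by (simp add: add_edge_def)
      \<comment> \<open>Handles the four rim cases uniformly: \<open>x'\<close> and
        \<open>y'\<close> are the ends of the chord, \<open>p'\<close> and \<open>q'\<close> the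
        tips, and the new edge is \<open>x'p'\<close>. The witnesses are \<open>y'\<close> for
        \<open>w\<close> and \<open>q'\<close> for \<open>z\<close>.\<close>
      have outer_edge: "\<exists>w z. ?adj u w \<and> ?adj v w \<and> ?adj w z \<and> (?adj u z \<or> ?adj v z)"
        if "{x', p'} = {u, v}" "?adj x' y'" "?adj p' y'" "?adj y' q'" "?adj x' q'" for x' y' p' q'
        using that unfolding doubleton_eq_iff by blast
      note old_xy = xy(2-6)[THEN old]
      \<comment> \<open>Since \<open>G\<close> has no diamond, one of the five edges must be the
        added one.\<close>
      consider "{x, y} = {u, v}" | "{x, p} = {u, v}" | "{y, p} = {u, v}" | "{x, q} = {u, v}"
        | "{y, q} = {u, v}"
        using no_diamond[OF xy(1), of x y] old_xy by argo
      then show ?thesis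
      proof cases
        case 1
        have "?adj x p" "?adj y p" "?adj x q" "?adj y q"
          using old_xy ne unfolding 1[symmetric] by (simp_all add: doubleton_eq_iff)
        then show ?thesis using 1 xy(1) unfolding doubleton_eq_iff by blast
      next
        case 2
        have "?adj x y" "?adj y p" "?adj y q" "?adj x q"
          using old_xy ne xy(1) unfolding 2[symmetric] by (simp_all add: doubleton_eq_iff)
        then show ?thesis using outer_edge[OF 2, of y q] sym[of y p] by blast
      next
        case 3
        have "?adj x y" "?adj x p" "?adj x q" "?adj y q"
          using old_xy ne xy(1) unfolding 3[symmetric] by (simp_all add: doubleton_eq_iff)
        then show ?thesis using outer_edge[OF 3, of x q] sym[of x y] sym[of x p] by blast
      next
        case 4
        have "?adj x y" "?adj x p" "?adj y p" "?adj y q"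
          using old_xy ne xy(1) unfolding 4[symmetric] by (simp_all add: doubleton_eq_iff)
        then show ?thesis using outer_edge[OF 4, of y p] sym[of y q] by blast
      next
        case 5
        have "?adj x y" "?adj x p" "?adj y p" "?adj x q"
          using old_xy ne xy(1) unfolding 5[symmetric] by (simp_all add: doubleton_eq_iff)
        then show ?thesis using outer_edge[OF 5, of x p] sym[of x y] sym[of x q] by blast
      qed
    qed
    show "r = p \<or> r = q \<or> p = q"
      if uv: "u \<noteq> v" "\<not> ?adj u v" and e: "?adj u p" "?adj v p" "?adj u q" "?adj v q" "?adj u r" "?adj v r"
      for u v p q r
    proof (rule ccontr)
      assume "\<not> ?thesis"
      then have n: "r \<noteq> p" "r \<noteq> q" "p \<noteq> q" "p \<noteq> r" by auto
      have "diamond u v p q = diamond u v p r"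
        using uv n edgeD(1)[OF e(1)] edgeD(1)[OF e(2)] e by (intro unique[of u v]) simp_all
      then have "verts (diamond u v p q) = verts (diamond u v p r)" by simp
      then have "r \<in> {u, v, p, q}" by (auto simp: diamond_def)
      then show False using n edgeD(3)[OF e(5)] edgeD(3)[OF e(6)] by simp
    qed
    show "q = p"
      if uv: "u \<noteq> v" "\<not> ?adj u v" and e: "?adj u p" "?adj v p" "?adj u q" "?adj v q" "?adj u z" "?adj p z"
      for u v p q z
    proof (rule ccontr)
      assume n: "q \<noteq> p"
      have "v \<noteq> z" using uv e by auto
      \<comment> \<open>The first diamond has the new edge as its chord. In the second the chord is
        \<open>up\<close>, the tips are \<open>v\<close> and \<open>z\<close>, and the new edge lies
        on the rim.\<close>
      then have "diamond u v p q = diamond u p v z"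
        using uv n edgeD(1)[OF e(1)] edgeD(1)[OF e(2)] e sym[of p v]
        by (intro unique[of u v]) simp_all
      then have "verts (diamond u v p q) = verts (diamond u p v z)" by simp
      then have "q \<in> {u, p, v, z}" by (auto simp: diamond_def)
      then have "q = z" using n edgeD(3)[OF e(3)] edgeD(3)[OF e(4)] by simp
      \<comment> \<open>With \<open>q = z\<close> the vertices \<open>p\<close> and \<open>q\<close>
        are adjacent, so \<open>G\<close> itself contains the diamond with chord \<open>pq\<close>
        and tips \<open>u\<close> and \<open>v\<close>.\<close>
      then show False
        using no_diamond[of u v p q] uv(1) e sym[of u p] sym[of u q] sym[of v p] sym[of v q] by simp
    qed
  qed
  then show thesis by (rule that)
qed

lemma uniquely_saturated_one_triangle_isomorphic:
  fixes G :: "'a ugraph"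
  assumes "nontrivial_uniquely_saturated C4_plus G" "exactly_one_triangle G"
  shows "isomorphic G C3_star"
proof -
  have us: "uniquely_saturated C4_plus G" and "card (verts C4_plus) \<le> card (verts G)"
    using assms(1) by (simp_all add: nontrivial_uniquely_saturated_def)
  then have G: "simple_graph G" and card_G: "4 \<le> card (verts G)"
    by (simp_all add: uniquely_saturated_def C4_plus_def C4_def add_edge_def)
  obtain T where "one_triangle_saturated (verts G) (\<lambda>x y. {x, y} \<in> edges G) T"
    using uniquely_saturated_imp_locale[OF us assms(2)] .
  then interpret one_triangle_saturated "verts G" "\<lambda>x y. {x, y} \<in> edges G" T .
  \<comment> \<open>Nontriviality enters here: a fourth vertex exists, and by
    \<open>outside_unique\<close> it is the only one outside \<open>T\<close>.\<close>
  have "\<not> verts G \<subseteq> T"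
    using card_mono[of T "verts G"] card_T card_G finite_subset[OF T_V finite_V] by auto
  then obtain v where v: "v \<in> verts G" "v \<notin> T" by blast
  then obtain a where a: "a \<in> T" "v \<in> outer a" using outside_T_cases far_empty by blast
  obtain b where b: "b \<in> T" "b \<noteq> a" using third_T a by blast
  obtain c where c: "c \<in> T" "c \<noteq> a" "c \<noteq> b" using third_T a b by blast
  have T: "T = {a, b, c}"
    using card_T a b c by (intro card_subset_eq[symmetric] card_ge_0_finite) auto
  have V: "verts G = {a, b, c, v}" using T T_V v outside_unique by blast
  have ne: "v \<noteq> a" "v \<noteq> b" "v \<noteq> c" using v T by auto
  have in_E: "{{a, b}, {b, c}, {c, a}, {a, v}} \<subseteq> edges G"
    using T_adj a b c outerD[OF a(2)] by auto
  have notin_E: "{b, v} \<notin> edges G" "{c, v} \<notin> edges G"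
    using outer_adj_T[OF a] b c by auto
  have E: "edges G = {{a, b}, {b, c}, {c, a}, {a, v}}"
  proof (rule antisym[OF subsetI in_E])
    fix e assume e: "e \<in> edges G"
    obtain x y where "e = {x, y}" "x \<in> verts G" "y \<in> verts G" "x \<noteq> y"
      using simple_graph_edgeE[OF G e] .
    then show "e \<in> {{a, b}, {b, c}, {c, a}, {a, v}}"
      using V notin_E e by (auto simp: insert_commute[of _ _ "{}"])
  qed
  \<comment> \<open>In \<open>C3_star\<close> the vertex 0 carries the pendant edge and 3 is its
    free end, so they correspond to \<open>a\<close> and \<open>v\<close>.\<close>
  let ?g = "\<lambda>i::nat. if i = 0 then a else if i = 1 then b else if i = 2 then c else v"
  have "G = image_graph ?g C3_star"
    using V E by (cases G) (simp add: image_graph_def C3_star_def insert_commute)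
  moreover have "inj_on ?g (verts C3_star)"
    using b c ne by (auto simp: C3_star_def inj_on_def)
  ultimately show ?thesis using isomorphic_image_graph[OF simple_graph_C3_star] by metis
qed

theorem theorem3p6:
  shows "nontrivial_uniquely_saturated C4_plus C3_star \<and> exactly_one_triangle C3_star \<and>
    (\<forall>G :: 'a ugraph. nontrivial_uniquely_saturated C4_plus G \<and> exactly_one_triangle G
       \<longrightarrow> isomorphic G C3_star)"
  using nontrivial_uniquely_saturated_C3_star exactly_one_triangle_C3_star
    uniquely_saturated_one_triangle_isomorphic by blast

end
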